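(* Let $\mathscr{C}_{\mathbb{Z}}$ be the extended bicyclic semigroup. The following statements hold: (i) $E(\mathscr{C}_{\mathbb{Z}})=\{(a,a)\mid a\in\mathbb{Z}\}$, and $(a,a)\leqslant(b,b)$ in $E(\mathscr{C}_{\mathbb{Z}})$ if and only if $a\geqslant b$ in $\mathbb{Z}$, and hence $E(\mathscr{C}_{\mathbb{Z}})$ is isomorphic to the linearly ordered semilattice $(\mathbb{Z},\max)$; (ii) $\mathscr{C}_{\mathbb{Z}}$ is an inverse semigroup, and the elements $(a,b)$ and $(b,a)$ are inverse in $\mathscr{C}_{\mathbb{Z}}$; (iii) for any idempotents $e,f\in\mathscr{C}_{\mathbb{Z}}$ there exists $x\in\mathscr{C}_{\mathbb{Z}}$ such that $x\cdot x^{-1}=e$ and $x^{-1}\cdot x=f$; (iv) elements $(a,b)$ and $(c,d)$ of $\mathscr{C}_{\mathbb{Z}}$ are: (a) $\mathscr{R}$-equivalent if and only if $a=c$; (b) $\mathscr{L}$-equivalent if and only if $b=d$; (c) $\mathscr{H}$-equivalent if and only if $a=c$ and $b=d$; (d) $\mathscr{D}$-equivalent for all $a,b,c,d\in\mathbb{Z}$; (e) $\mathscr{J}$-equivalent for all $a,b,c,d\in\mathbb{Z}$; (v) $\mathscr{C}_{\mathbb{Z}}$ is a bisimple semigroup and hence it is simple; (vi) if $(a,b)\cdot(c,d)=(x,y)$ in $\mathscr{C}_{\mathbb{Z}}$, then $x-y=a-b+c-d$; (vii) every maximal subgroup of $\mathscr{C}_{\mathbb{Z}}$ is trivial; (viii)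 for every integer $n$ the subsemigroup $\mathscr{C}_{\mathbb{Z}}[n]=\{(a,b)\mid a\geqslant n \text{ and } b\geqslant n\}$ of $\mathscr{C}_{\mathbb{Z}}$ is isomorphic to the bicyclic semigroup $\mathscr{C}(p,q)$, and moreover an isomorphism $h\colon\mathscr{C}_{\mathbb{Z}}[n]\to\mathscr{C}(p,q)$ is defined by the formula $h(a,b)=q^{a-n}p^{b-n}$; (ix) $\{\mathscr{L}^a\mid a\in\mathbb{Z}\}$, where $\mathscr{L}^a=\{(x,y)\in\mathscr{C}_{\mathbb{Z}}\mid y\geqslant a\}$, is the family of all left ideals of the semigroup $\mathscr{C}_{\mathbb{Z}}$; (x) $\{\mathscr{R}^a\mid a\in\mathbb{Z}\}$, where $\mathscr{R}^a=\{(x,y)\in\mathscr{C}_{\mathbb{Z}}\mid x\geqslant a\}$, is the family of all right ideals of the semigroup $\mathscr{C}_{\mathbb{Z}}$.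
   Context: The extended bicyclic semigroup $\mathscr{C}_{\mathbb{Z}}$ is the set $\mathbb{Z}\times\mathbb{Z}$ with the operation $(a,b)\cdot(c,d)=(a-b+c,d)$ if $b<c$; $(a,b)\cdot(c,d)=(a,d)$ if $b=c$; $(a,b)\cdot(c,d)=(a,d+b-c)$ if $b>c$. The bicyclic semigroup $\mathscr{C}(p,q)$ is the semigroup with identity $1$ generated by $p,q$ subject only to $pq=1$; its distinct elements are $q^ip^j$, $i,j\geqslant 0$. $E(S)$ is the set of idempotents of a semigroup $S$; for commuting idempotents the natural partial order is $e\leqslant f$ iff $ef=fe=e$. A semilattice is a commutative semigroup of idempotents; it is linearly ordered if its natural partial order is linear. A semigroup $S$ is inverse if every $x\in S$ has a unique $x^{-1}\in S$ (the inverse of $x$) with $xx^{-1}x=x$ and $x^{-1}xx^{-1}=x^{-1}$. Green's relations on $S$: $a\mathscr{R}b$ iff $aS^1=bS^1$; $a\mathscr{L}b$ iff $S^1a=S^1b$; $a\mathscr{J}b$ iff $S^1aS^1=S^1bS^1$; $\mathscr{D}=\mathscr{L}\circ\mathscr{R}=\mathscr{R}\circ\mathscr{L}$; $\mathscr{H}=\mathscr{L}\cap\mathscr{R}$, where $S^1$ is $S$ with an identity adjoined if necessary. $S$ is simple if it does not contain proper two-sided ideals (ideals different from $S$) and bisimple if it has only one $\mathscr{D}$-class.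
   Formalization: In (ix) and (x) the families are shown to be all nonempty left (right) ideals different from the whole semigroup; as worded the claim fails, since the extended bicyclic semigroup is itself a left and right ideal and is none of the sets L^a or R^a. *)

theory Defs
  imports "HOL-Algebra.Group"
begin

section \<open>Semigroup notions\<close>

text \<open>
  A semigroup is a type together with a binary operation \<open>f\<close> on it satisfying the library
  predicate \<^const>\<open>semigroup\<close>.  Subsemigroups, ideals and subgroups are subsets of the type.
\<close>

definition idempotents :: "('a \<Rightarrow> 'a \<Rightarrow> 'a) \<Rightarrow> 'a set" where
  "idempotents f = {e. f e e = e}"

definition natural_le :: "('a \<Rightarrow> 'a \<Rightarrow> 'a) \<Rightarrow> 'a \<Rightarrow> 'a \<Rightarrow> bool" where
  "natural_le f e g \<longleftrightarrow> f e g = e \<and> f g e = e"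

definition linearly_ordered_semilattice :: "('a \<Rightarrow> 'a \<Rightarrow> 'a) \<Rightarrow> bool" where
  "linearly_ordered_semilattice f \<longleftrightarrow>
     semilattice f \<and> (\<forall>e g. natural_le f e g \<or> natural_le f g e)"

definition subsemigroup :: "('a \<Rightarrow> 'a \<Rightarrow> 'a) \<Rightarrow> 'a set \<Rightarrow> bool" where
  "subsemigroup f S \<longleftrightarrow> semigroup f \<and> S \<noteq> {} \<and> (\<forall>x\<in>S. \<forall>y\<in>S. f x y \<in> S)"

text \<open>\<open>h\<close> is an isomorphism from the semigroup \<open>(S, f)\<close> onto the semigroup \<open>(T, g)\<close>.\<close>

definition semigroup_isomorphism ::
    "('a \<Rightarrow> 'a \<Rightarrow> 'a) \<Rightarrow> 'a set \<Rightarrow> ('b \<Rightarrow> 'b \<Rightarrow> 'b) \<Rightarrow> 'b set \<Rightarrow> ('a \<Rightarrow> 'b) \<Rightarrow> bool" where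
  "semigroup_isomorphism f S g T h \<longleftrightarrow>
     subsemigroup f S \<and> subsemigroup g T \<and> bij_betw h S T \<and>
     (\<forall>x\<in>S. \<forall>y\<in>S. h (f x y) = g (h x) (h y))"

definition isomorphic_semigroups ::
    "('a \<Rightarrow> 'a \<Rightarrow> 'a) \<Rightarrow> 'a set \<Rightarrow> ('b \<Rightarrow> 'b \<Rightarrow> 'b) \<Rightarrow> 'b set \<Rightarrow> bool" where
  "isomorphic_semigroups f S g T \<longleftrightarrow> (\<exists>h. semigroup_isomorphism f S g T h)"

definition inverse_elements :: "('a \<Rightarrow> 'a \<Rightarrow> 'a) \<Rightarrow> 'a \<Rightarrow> 'a \<Rightarrow> bool" where
  "inverse_elements f x y \<longleftrightarrow> f (f x y) x = x \<and> f (f y x) y = y"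

definition inverse_semigroup :: "('a \<Rightarrow> 'a \<Rightarrow> 'a) \<Rightarrow> bool" where
  "inverse_semigroup f \<longleftrightarrow> semigroup f \<and> (\<forall>x. \<exists>!y. inverse_elements f x y)"

definition inverse_of :: "('a \<Rightarrow> 'a \<Rightarrow> 'a) \<Rightarrow> 'a \<Rightarrow> 'a" where
  "inverse_of f x = (THE y. inverse_elements f x y)"

text \<open>
  The semigroup \<open>S\<^sup>1\<close> is realised inside \<^typ>\<open>'a option\<close>, with \<^const>\<open>None\<close> as the adjoined
  identity; \<^const>\<open>None\<close> belongs to it only if there is no identity already.
\<close>

fun mult1 :: "('a \<Rightarrow> 'a \<Rightarrow> 'a) \<Rightarrow> 'a option \<Rightarrow> 'a option \<Rightarrow> 'a option" where
  "mult1 f None y = y"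
| "mult1 f (Some x) None = Some x"
| "mult1 f (Some x) (Some y) = Some (f x y)"

definition carrier1 :: "('a \<Rightarrow> 'a \<Rightarrow> 'a) \<Rightarrow> 'a option set" where
  "carrier1 f = (if \<exists>e. \<forall>x. f e x = x \<and> f x e = x then range Some else UNIV)"

definition green_R :: "('a \<Rightarrow> 'a \<Rightarrow> 'a) \<Rightarrow> 'a \<Rightarrow> 'a \<Rightarrow> bool" where
  "green_R f a b \<longleftrightarrow>
     {mult1 f (Some a) s | s. s \<in> carrier1 f} = {mult1 f (Some b) s | s. s \<in> carrier1 f}"

definition green_L :: "('a \<Rightarrow> 'a \<Rightarrow> 'a) \<Rightarrow> 'a \<Rightarrow> 'a \<Rightarrow> bool" where
  "green_L f a b \<longleftrightarrow>
     {mult1 f s (Some a) | s. s \<in> carrier1 f} = {mult1 f s (Some b) | s. s \<in> carrier1 f}"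

definition green_J :: "('a \<Rightarrow> 'a \<Rightarrow> 'a) \<Rightarrow> 'a \<Rightarrow> 'a \<Rightarrow> bool" where
  "green_J f a b \<longleftrightarrow>
     {mult1 f (mult1 f s (Some a)) t | s t. s \<in> carrier1 f \<and> t \<in> carrier1 f} =
     {mult1 f (mult1 f s (Some b)) t | s t. s \<in> carrier1 f \<and> t \<in> carrier1 f}"

definition green_H :: "('a \<Rightarrow> 'a \<Rightarrow> 'a) \<Rightarrow> 'a \<Rightarrow> 'a \<Rightarrow> bool" where
  "green_H f a b \<longleftrightarrow> green_L f a b \<and> green_R f a b"

definition green_D :: "('a \<Rightarrow> 'a \<Rightarrow> 'a) \<Rightarrow> 'a \<Rightarrow> 'a \<Rightarrow> bool" where
  "green_D f = green_L f OO green_R f"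

definition bisimple :: "('a \<Rightarrow> 'a \<Rightarrow> 'a) \<Rightarrow> bool" where
  "bisimple f \<longleftrightarrow> is_singleton (range (\<lambda>a. {b. green_D f a b}))"

text \<open>As usual in semigroup theory, ideals are nonempty.\<close>

definition left_ideal :: "('a \<Rightarrow> 'a \<Rightarrow> 'a) \<Rightarrow> 'a set \<Rightarrow> bool" where
  "left_ideal f I \<longleftrightarrow> I \<noteq> {} \<and> (\<forall>s. \<forall>x\<in>I. f s x \<in> I)"

definition right_ideal :: "('a \<Rightarrow> 'a \<Rightarrow> 'a) \<Rightarrow> 'a set \<Rightarrow> bool" where
  "right_ideal f I \<longleftrightarrow> I \<noteq> {} \<and> (\<forall>s. \<forall>x\<in>I. f x s \<in> I)"

definition simple :: "('a \<Rightarrow> 'a \<Rightarrow> 'a) \<Rightarrow> bool" where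
  "simple f \<longleftrightarrow> \<not> (\<exists>I. left_ideal f I \<and> right_ideal f I \<and> I \<noteq> UNIV)"

text \<open>The identity of a subgroup need not be an identity of the whole semigroup.\<close>

definition subgroup_of_semigroup :: "('a \<Rightarrow> 'a \<Rightarrow> 'a) \<Rightarrow> 'a set \<Rightarrow> bool" where
  "subgroup_of_semigroup f G \<longleftrightarrow> (\<exists>e. group \<lparr>carrier = G, mult = f, one = e\<rparr>)"

definition maximal_subgroup :: "('a \<Rightarrow> 'a \<Rightarrow> 'a) \<Rightarrow> 'a set \<Rightarrow> bool" where
  "maximal_subgroup f G \<longleftrightarrow>
     subgroup_of_semigroup f G \<and> (\<forall>H. subgroup_of_semigroup f H \<and> G \<subseteq> H \<longrightarrow> H = G)"


section \<open>The bicyclic semigroup\<close>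

text \<open>
  The monoid presentation \<open>\<langle>p, q | pq = 1\<rangle>\<close>: words over \<open>{p, q}\<close> modulo the congruence generated
  by \<open>pq = 1\<close>, that is, the equivalence generated by deleting factors \<open>pq\<close>.
\<close>

datatype letter = P | Q

definition delete_pq :: "letter list \<Rightarrow> letter list \<Rightarrow> bool" where
  "delete_pq w w' \<longleftrightarrow> (\<exists>u v. w = u @ [P, Q] @ v \<and> w' = u @ v)"

definition bicyclic_cong :: "letter list \<Rightarrow> letter list \<Rightarrow> bool" where
  "bicyclic_cong = equivclp delete_pq"

lemma delete_pq_append:
  assumes "delete_pq w w'"
  shows "delete_pq (u @ w @ v) (u @ w' @ v)"
proof -
  obtain x y where "w = x @ [P, Q] @ y" "w' = x @ y"
    using assms by (auto simp: delete_pq_def)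
  then have "u @ w @ v = (u @ x) @ [P, Q] @ (y @ v)" "u @ w' @ v = (u @ x) @ (y @ v)"
    by simp_all
  then show ?thesis unfolding delete_pq_def by blast
qed

lemma bicyclic_cong_append1:
  assumes "bicyclic_cong w w'"
  shows "bicyclic_cong (u @ w @ v) (u @ w' @ v)"
  using assms unfolding bicyclic_cong_def
proof (induction rule: equivclp_induct)
  case base
  show ?case by simp
next
  case (step y z)
  from step(2) have "delete_pq (u @ y @ v) (u @ z @ v) \<or> delete_pq (u @ z @ v) (u @ y @ v)"
    using delete_pq_append by blast
  with step(3) show ?case
    by (meson equivclp_into_equivclp)
qed

lemma bicyclic_cong_append:
  assumes "bicyclic_cong w w'" "bicyclic_cong v v'"
  shows "bicyclic_cong (w @ v) (w' @ v')"
  using bicyclic_cong_append1[OF assms(1), of "[]" v] bicyclic_cong_append1[OF assms(2), of w' "[]"]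
  unfolding bicyclic_cong_def by (auto intro: equivclp_trans)

quotient_type bicyclic = "letter list" / bicyclic_cong
  unfolding bicyclic_cong_def by simp

instantiation bicyclic :: monoid_mult
begin

lift_definition one_bicyclic :: bicyclic is "[]" .

lift_definition times_bicyclic :: "bicyclic \<Rightarrow> bicyclic \<Rightarrow> bicyclic" is "(@)"
  by (rule bicyclic_cong_append)

instance
  by standard (transfer; simp add: bicyclic_cong_def)+

end

lift_definition bicyclic_p :: bicyclic is "[P]" .

lift_definition bicyclic_q :: bicyclic is "[Q]" .


section \<open>The extended bicyclic semigroup\<close>

fun ext_mult :: "int \<times> int \<Rightarrow> int \<times> int \<Rightarrow> int \<times> int"  (infixl "\<odot>" 70) where
  "(a, b) \<odot> (c, d) =
     (if b < c then (a - b + c, d) else if b = c then (a, d) else (a, d + b - c))"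

definition ext_from :: "int \<Rightarrow> (int \<times> int) set" where
  "ext_from n = {(a, b). a \<ge> n \<and> b \<ge> n}"

definition ext_left :: "int \<Rightarrow> (int \<times> int) set" where
  "ext_left a = {(x, y). y \<ge> a}"

definition ext_right :: "int \<Rightarrow> (int \<times> int) set" where
  "ext_right a = {(x, y). x \<ge> a}"

end

theory Submission
  imports Defs
begin

text \<open>
  The three cases of the multiplication collapse to
  \<open>(a, b)(c, d) = (a - b + m, d - c + m)\<close> with \<open>m = max b c\<close>.  From this the principal right ideal of
  \<open>(a, b)\<close> is \<open>{(x, y). x \<ge> a}\<close> and the principal left ideal is \<open>{(x, y). y \<ge> b}\<close>, which yields
  Green's relations, all one-sided ideals, and the triviality of the subgroups.

  For the bicyclic semigroup, \<open>pq = 1\<close> allows every element to be written as \<open>q\<^sup>i p\<^sup>j\<close>; letting \<open>p\<close> and \<open>q\<close>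
  act as left multiplication by \<open>(0, 1)\<close> and \<open>(1, 0)\<close> on the quadrant \<open>{(a, b). a \<ge> 0 \<and> b \<ge> 0}\<close> respects the
  relation \<open>pq = 1\<close>, and applying \<open>q\<^sup>i p\<^sup>j\<close> to \<open>(0, 0)\<close> recovers \<open>(i, j)\<close>, so these forms are distinct.
\<close>

section \<open>The extended bicyclic semigroup\<close>

lemma ext_mult_max: "(a, b) \<odot> (c, d) = (a - b + max b c, d - c + max b c)"
  by auto

declare ext_mult.simps [simp del]

lemma semigroup_ext_mult: "semigroup (\<odot>)"
proof
  fix x y z :: "int \<times> int"
  show "x \<odot> y \<odot> z = x \<odot> (y \<odot> z)"
    by (cases x; cases y; cases z) (auto simp: ext_mult_max)
qed

section \<open>Idempotents and inverses\<close>

lemma ext_mult_idempotent_iff: "(a, b) \<odot> (a, b) = (a, b) \<longleftrightarrow> a = b"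
  by (auto simp: ext_mult_max)

lemma idempotents_ext_mult: "idempotents (\<odot>) = {(a, a) | a. a \<in> UNIV}"
  by (auto simp: idempotents_def ext_mult_idempotent_iff)

lemma natural_le_ext_mult: "natural_le (\<odot>) (a, a) (b, b) \<longleftrightarrow> a \<ge> b"
  by (auto simp: natural_le_def ext_mult_max)

lemma linearly_ordered_semilattice_max:
  "linearly_ordered_semilattice (max :: 'a::linorder \<Rightarrow> 'a \<Rightarrow> 'a)"
proof -
  have "natural_le max e g \<or> natural_le max g e" for e g :: 'a
    by (auto simp: natural_le_def max_def)
  then show ?thesis
    by (simp add: linearly_ordered_semilattice_def max.semilattice_axioms)
qed

text \<open>With \<open>m = max a b\<close>, the formula for the product gives
  \<open>(a, a) \<odot> (b, b) = (m, m)\<close>, so reading off either coordinate turns the product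
  into \<open>max\<close>.\<close>

lemma idempotents_ext_mult_isomorphism:
  "semigroup_isomorphism (\<odot>) (idempotents (\<odot>)) (max :: int \<Rightarrow> int \<Rightarrow> int) UNIV fst"
  by (auto simp: semigroup_isomorphism_def subsemigroup_def idempotents_ext_mult ext_mult_max
      semigroup_ext_mult max.semigroup_axioms bij_betw_def inj_on_def image_iff)

text \<open>A product never has a smaller first coordinate than its left factor, nor a smaller
  second coordinate than its right factor. Hence the first equation forces \<open>c \<le> b\<close>
  and \<open>d \<le> a\<close>, and the second the reverse inequalities. Stated as an equivalence,
  this yields existence and uniqueness of inverses together.\<close>

lemma inverse_elements_ext_mult:
  "inverse_elements (\<odot>) (a, b) (c, d) \<longleftrightarrow> c = b \<and> d = a"
  by (auto simp: inverse_elements_def ext_mult_max)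

lemma inverse_semigroup_ext_mult: "inverse_semigroup (\<odot>)"
  by (auto simp: inverse_semigroup_def semigroup_ext_mult inverse_elements_ext_mult)

lemma inverse_of_ext_mult: "inverse_of (\<odot>) (a, b) = (b, a)"
  unfolding inverse_of_def by (rule the_equality) (auto simp: inverse_elements_ext_mult)

section \<open>Principal one-sided ideals\<close>

lemma range_ext_mult_right: "range (\<lambda>s. (a, b) \<odot> s) = ext_right a"
proof
  show "range (\<lambda>s. (a, b) \<odot> s) \<subseteq> ext_right a"
    by (auto simp: ext_right_def ext_mult_max)
  show "ext_right a \<subseteq> range (\<lambda>s. (a, b) \<odot> s)"
  proof
    fix z assume "z \<in> ext_right a"
    \<comment> \<open>Since \<open>fst z \<ge> a\<close>, the right factor has first coordinate at
      least \<open>b\<close>; the maximum is then attained there, and the shift by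
      \<open>a - b\<close> lands on \<open>fst z\<close>.\<close>
    then have "z = (a, b) \<odot> (b + (fst z - a), snd z)"
      by (cases z) (auto simp: ext_right_def ext_mult_max)
    then show "z \<in> range (\<lambda>s. (a, b) \<odot> s)" by blast
  qed
qed

lemma range_ext_mult_left: "range (\<lambda>s. s \<odot> (a, b)) = ext_left b"
proof
  show "range (\<lambda>s. s \<odot> (a, b)) \<subseteq> ext_left b"
    by (auto simp: ext_left_def ext_mult_max)
  show "ext_left b \<subseteq> range (\<lambda>s. s \<odot> (a, b))"
  proof
    fix z assume "z \<in> ext_left b"
    then have "z = (fst z, a + (snd z - b)) \<odot> (a, b)"
      by (cases z) (auto simp: ext_left_def ext_mult_max)
    then show "z \<in> range (\<lambda>s. s \<odot> (a, b))" by blast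
  qed
qed

lemma ext_right_eq_iff: "ext_right a = ext_right b \<longleftrightarrow> a = b"
  by (auto simp: ext_right_def set_eq_iff intro: order_antisym)

lemma ext_left_eq_iff: "ext_left a = ext_left b \<longleftrightarrow> a = b"
  by (auto simp: ext_left_def set_eq_iff intro: order_antisym)

section \<open>Green's relations and ideals\<close>

lemma Some_in_carrier1 [simp]: "Some x \<in> carrier1 f"
  by (simp add: carrier1_def)

text \<open>
  An element lying in its own principal one-sided ideal makes the adjoined identity irrelevant.
\<close>

lemma mult1_right_image:
  assumes "x \<in> range (f x)"
  shows "{mult1 f (Some x) s | s. s \<in> carrier1 f} = Some ` range (f x)"
proof -
  have "mult1 f (Some x) s \<in> Some ` range (f x)" for s
    using assms by (cases s) auto
  moreover have "\<exists>s. Some (f x y) = mult1 f (Some x) s \<and> s \<in> carrier1 f" for y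
    by (rule exI[of _ "Some y"]) simp
  ultimately show ?thesis
    by (intro equalityI subsetI) (auto simp del: mult1.simps)
qed

lemma mult1_left_image:
  assumes "x \<in> range (\<lambda>s. f s x)"
  shows "{mult1 f s (Some x) | s. s \<in> carrier1 f} = Some ` range (\<lambda>s. f s x)"
proof -
  have "mult1 f s (Some x) \<in> Some ` range (\<lambda>s. f s x)" for s
    using assms by (cases s) auto
  moreover have "\<exists>s. Some (f y x) = mult1 f s (Some x) \<and> s \<in> carrier1 f" for y
    by (rule exI[of _ "Some y"]) simp
  ultimately show ?thesis
    by (intro equalityI subsetI) (auto simp del: mult1.simps)
qed

text \<open>The resulting set does not depend on \<open>x\<close>, so once every \<open>x\<close>
  satisfies the assumption, all elements are \<open>\<J>\<close>-equivalent. \<open>None\<close>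
  never occurs because \<open>Some x\<close> is always a factor.\<close>

lemma mult1_two_sided_image:
  assumes "\<And>z. \<exists>s t. z = f (f s x) t"
  shows "{mult1 f (mult1 f s (Some x)) t | s t. s \<in> carrier1 f \<and> t \<in> carrier1 f} = range Some"
proof -
  have "mult1 f (mult1 f s (Some x)) t \<in> range Some" for s t
    by (cases s; cases t) auto
  moreover have "\<exists>s t. Some z = mult1 f (mult1 f s (Some x)) t \<and> s \<in> carrier1 f \<and> t \<in> carrier1 f"
    for z
    using assms[of z] by (metis Some_in_carrier1 mult1.simps(3))
  ultimately show ?thesis
    by (intro equalityI subsetI) (auto simp del: mult1.simps)
qed

section \<open>Green's relations of the extended bicyclic semigroup\<close>

lemma green_R_ext_mult: "green_R (\<odot>) (a, b) (c, d) \<longleftrightarrow> a = c"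
proof -
  have "{mult1 (\<odot>) (Some (a, b)) s | s. s \<in> carrier1 (\<odot>)} = Some ` ext_right a" for a b
    by (subst mult1_right_image) (simp_all only: range_ext_mult_right, simp add: ext_right_def)
  then show ?thesis
    by (simp add: green_R_def inj_image_eq_iff ext_right_eq_iff)
qed

lemma green_L_ext_mult: "green_L (\<odot>) (a, b) (c, d) \<longleftrightarrow> b = d"
proof -
  have "{mult1 (\<odot>) s (Some (a, b)) | s. s \<in> carrier1 (\<odot>)} = Some ` ext_left b" for a b
    by (subst mult1_left_image) (simp_all only: range_ext_mult_left, simp add: ext_left_def)
  then show ?thesis
    by (simp add: green_L_def inj_image_eq_iff ext_left_eq_iff)
qed

lemma green_H_ext_mult: "green_H (\<odot>) (a, b) (c, d) \<longleftrightarrow> a = c \<and> b = d"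
  by (auto simp: green_H_def green_L_ext_mult green_R_ext_mult)

lemma green_D_ext_mult: "green_D (\<odot>) x y"
proof -
  \<comment> \<open>The intermediate element must share its second coordinate with \<open>x\<close>
    and its first with \<open>y\<close>.\<close>
  have "green_L (\<odot>) x (fst y, snd x)" "green_R (\<odot>) (fst y, snd x) y"
    by (cases x; cases y; simp add: green_L_ext_mult green_R_ext_mult)+
  then show ?thesis
    unfolding green_D_def by blast
qed

text \<open>Adjacent inner coordinates agree, so the factors multiply like matrix units. This one
  factorization serves both \<open>green_J\<close> and simplicity.\<close>

lemma ext_mult_factor: "z = ((fst z, fst x) \<odot> x) \<odot> (snd x, snd z)"
  by (cases x; cases z) (simp add: ext_mult_max)

lemma green_J_ext_mult: "green_J (\<odot>) x y"
proof -
  have "\<exists>s t. z = s \<odot> x \<odot> t" for x z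
    using ext_mult_factor by blast
  then show ?thesis
    by (simp add: green_J_def mult1_two_sided_image)
qed

section \<open>Bisimplicity and simplicity\<close>

lemma bisimple_ext_mult: "bisimple (\<odot>)"
  by (simp add: bisimple_def green_D_ext_mult is_singleton_def)

lemma simple_ext_mult: "simple (\<odot>)"
proof -
  have "I = UNIV" if "left_ideal (\<odot>) I" "right_ideal (\<odot>) I" for I
  proof -
    obtain x where "x \<in> I"
      using \<open>left_ideal (\<odot>) I\<close> by (auto simp: left_ideal_def)
    then have "((fst z, fst x) \<odot> x) \<odot> (snd x, snd z) \<in> I" for z
      using that by (simp add: left_ideal_def right_ideal_def)
    then show ?thesis
      by (auto simp flip: ext_mult_factor)
  qed
  then show ?thesis
    unfolding simple_def by blast
qed

section \<open>Subgroups\<close>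

lemma subgroup_ext_mult_singleton:
  assumes "subgroup_of_semigroup (\<odot>) G"
  shows "is_singleton G"
proof -
  obtain e where "group \<lparr>carrier = G, mult = (\<odot>), one = e\<rparr>" (is "group ?G")
    using assms by (auto simp: subgroup_of_semigroup_def)
  then interpret group ?G .
  have "e \<in> G" "e \<odot> e = e"
    using one_closed l_one[OF one_closed] by simp_all
  then obtain k where e: "e = (k, k)"
    by (cases e) (auto simp: ext_mult_idempotent_iff)
  have "x = e" if "x \<in> G" for x
  proof -
    define y where "y = inv\<^bsub>?G\<^esub> x"
    have "y \<odot> x = e" "x \<odot> y = e"
      using l_inv[of x] r_inv[of x] that by (simp_all add: y_def)
    moreover have "e \<odot> x = x" "x \<odot> e = x"
      using l_one r_one that by simp_all
    \<comment> \<open>The identity laws place both coordinates of \<open>x\<close> at or above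
      \<open>k\<close>; since \<open>e\<close> is a multiple of \<open>x\<close> on either side,
      both are also at most \<open>k\<close>.\<close>
    ultimately show ?thesis
      by (cases x; cases y) (auto simp: e ext_mult_max max_def split: if_splits)
  qed
  with \<open>e \<in> G\<close> have "G = {e}"
    by blast
  then show ?thesis
    by (simp add: is_singleton_def)
qed

text \<open>A point outside \<open>I\<close> bounds \<open>g\<close> from below on \<open>I\<close>, so \<open>g\<close> attains a minimum on \<open>I\<close>.\<close>

lemma upward_closed_eq_level_set:
  fixes g :: "'a \<Rightarrow> int"
  assumes "I \<noteq> {}" "I \<noteq> UNIV" and up: "\<And>x z. x \<in> I \<Longrightarrow> g x \<le> g z \<Longrightarrow> z \<in> I"
  shows "\<exists>a. I = {z. a \<le> g z}"
proof -
  obtain z where "z \<notin> I"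
    using \<open>I \<noteq> UNIV\<close> by blast
  obtain x where x: "x \<in> I" "\<And>y. y \<in> I \<Longrightarrow> nat (g x - g z) \<le> nat (g y - g z)"
    using \<open>I \<noteq> {}\<close> ex_has_least_nat[of "\<lambda>x. x \<in> I" _ "\<lambda>x. nat (g x - g z)"] by blast
  have "g z < g y" if "y \<in> I" for y
    using up[OF that, of z] \<open>z \<notin> I\<close> by linarith
  \<comment> \<open>The differences \<open>g y - g z\<close> are positive on \<open>I\<close>, so
    \<open>nat\<close> truncates none of them, and the minimum found for their \<open>nat\<close>
    values is a minimum of \<open>g\<close>.\<close>
  with x have "g x \<le> g y" if "y \<in> I" for y
    using that by fastforce
  with up x(1) show ?thesis
    by blast
qed

text \<open>A left ideal contains the principal left ideal of each of its points, so it is upward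
  closed in the second coordinate. The whole semigroup is a left ideal with no least second
  coordinate, hence the restriction to \<open>I \<noteq> UNIV\<close>.\<close>

lemma left_ideals_ext_mult: "range ext_left = {I. left_ideal (\<odot>) I \<and> I \<noteq> UNIV}"
proof
  show "range ext_left \<subseteq> {I. left_ideal (\<odot>) I \<and> I \<noteq> UNIV}"
  proof clarify
    fix a
    have "(a, a) \<in> ext_left a" "(a, a - 1) \<notin> ext_left a"
      by (auto simp: ext_left_def)
    moreover have "s \<odot> x \<in> ext_left a" if "x \<in> ext_left a" for s x
      using that by (cases s; cases x) (auto simp: ext_left_def ext_mult_max)
    ultimately show "left_ideal (\<odot>) (ext_left a) \<and> ext_left a \<noteq> UNIV"
      unfolding left_ideal_def by blast
  qed
  show "{I. left_ideal (\<odot>) I \<and> I \<noteq> UNIV} \<subseteq> range ext_left"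
  proof clarify
    fix I assume I: "left_ideal (\<odot>) I" "I \<noteq> UNIV"
    have "z \<in> I" if "x \<in> I" "snd x \<le> snd z" for x z
    proof -
      have "z \<in> range (\<lambda>s. s \<odot> x)"
        using that range_ext_mult_left[of "fst x" "snd x"] by (auto simp: ext_left_def split_beta)
      then show ?thesis
        using I \<open>x \<in> I\<close> by (auto simp: left_ideal_def)
    qed
    then obtain a where "I = {z. a \<le> snd z}"
      using upward_closed_eq_level_set[of I snd] I by (auto simp: left_ideal_def)
    then show "I \<in> range ext_left"
      by (auto simp: ext_left_def split_beta)
  qed
qed

lemma right_ideals_ext_mult: "range ext_right = {I. right_ideal (\<odot>) I \<and> I \<noteq> UNIV}"
proof
  show "range ext_right \<subseteq> {I. right_ideal (\<odot>) I \<and> I \<noteq> UNIV}"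
  proof clarify
    fix a
    have "(a, a) \<in> ext_right a" "(a - 1, a) \<notin> ext_right a"
      by (auto simp: ext_right_def)
    moreover have "x \<odot> s \<in> ext_right a" if "x \<in> ext_right a" for s x
      using that by (cases s; cases x) (auto simp: ext_right_def ext_mult_max)
    ultimately show "right_ideal (\<odot>) (ext_right a) \<and> ext_right a \<noteq> UNIV"
      unfolding right_ideal_def by blast
  qed
  show "{I. right_ideal (\<odot>) I \<and> I \<noteq> UNIV} \<subseteq> range ext_right"
  proof clarify
    fix I assume I: "right_ideal (\<odot>) I" "I \<noteq> UNIV"
    have "z \<in> I" if "x \<in> I" "fst x \<le> fst z" for x z
    proof -
      have "z \<in> range (\<lambda>s. x \<odot> s)"
        using that range_ext_mult_right[of "fst x" "snd x"] by (auto simp: ext_right_def split_beta)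
      then show ?thesis
        using I \<open>x \<in> I\<close> by (auto simp: right_ideal_def)
    qed
    then obtain a where "I = {z. a \<le> fst z}"
      using upward_closed_eq_level_set[of I fst] I by (auto simp: right_ideal_def)
    then show "I \<in> range ext_right"
      by (auto simp: ext_right_def split_beta)
  qed
qed

section \<open>Normal forms in the bicyclic semigroup\<close>

lemma bicyclic_p_q: "bicyclic_p * bicyclic_q = 1"
proof transfer
  have "delete_pq ([P] @ [Q]) []"
    unfolding delete_pq_def by (metis append_Nil append_Cons)
  then show "bicyclic_cong ([P] @ [Q]) []"
    unfolding bicyclic_cong_def by blast
qed

lemma bicyclic_p_power_q_power: "bicyclic_p ^ k * bicyclic_q ^ k = 1"
proof (induction k)
  case (Suc k)
  \<comment> \<open>Splitting off the last \<open>bicyclic_p\<close> and the first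
    \<open>bicyclic_q\<close> makes them meet in the middle, where they cancel.\<close>
  have "bicyclic_p ^ Suc k * bicyclic_q ^ Suc k =
      bicyclic_p ^ k * (bicyclic_p * bicyclic_q) * bicyclic_q ^ k"
    by (simp only: power_Suc2[of bicyclic_p] power_Suc[of bicyclic_q] mult.assoc)
  then show ?case
    by (simp add: bicyclic_p_q Suc)
qed simp

text \<open>Cancelling \<open>min k l\<close> inner pairs leaves only the surplus letters. Truncated
  subtraction merges the two cases, since at least one exponent is \<open>0\<close>.\<close>

lemma bicyclic_p_power_mult_q_power:
  "bicyclic_p ^ k * bicyclic_q ^ l = bicyclic_q ^ (l - k) * bicyclic_p ^ (k - l)"
proof (cases "k \<le> l")
  case True
  then have "bicyclic_q ^ l = bicyclic_q ^ k * bicyclic_q ^ (l - k)"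
    by (simp flip: power_add)
  with True show ?thesis
    by (simp add: bicyclic_p_power_q_power flip: mult.assoc)
next
  case False
  then have "bicyclic_p ^ k = bicyclic_p ^ (k - l) * bicyclic_p ^ l"
    by (simp flip: power_add)
  with False show ?thesis
    by (simp add: bicyclic_p_power_q_power mult.assoc)
qed

text \<open>This mirrors \<open>ext_mult_max\<close>: over the integers, the new exponents are
  \<open>i - k + max k l\<close> and \<open>j - l + max k l\<close>.\<close>

lemma bicyclic_mult_normal_form:
  "(bicyclic_q ^ i * bicyclic_p ^ k) * (bicyclic_q ^ l * bicyclic_p ^ j) =
    bicyclic_q ^ (i + (l - k)) * bicyclic_p ^ ((k - l) + j)"
proof -
  have "(bicyclic_q ^ i * bicyclic_p ^ k) * (bicyclic_q ^ l * bicyclic_p ^ j) =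
      bicyclic_q ^ i * (bicyclic_p ^ k * bicyclic_q ^ l) * bicyclic_p ^ j"
    by (simp add: mult.assoc)
  then show ?thesis
    by (simp add: bicyclic_p_power_mult_q_power power_add mult.assoc)
qed

lemma bicyclic_normal_form: "\<exists>i j. x = bicyclic_q ^ i * bicyclic_p ^ j"
proof -
  have "\<exists>i j. abs_bicyclic w = bicyclic_q ^ i * bicyclic_p ^ j" for w
  proof (induction w)
    case Nil
    have "abs_bicyclic [] = bicyclic_q ^ 0 * bicyclic_p ^ 0"
      by (simp flip: one_bicyclic.abs_eq)
    then show ?case by blast
  next
    case (Cons l w)
    then obtain i j where w: "abs_bicyclic w = bicyclic_q ^ i * bicyclic_p ^ j"
      by blast
    have "abs_bicyclic (l # w) = abs_bicyclic [l] * abs_bicyclic w"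
      by (simp add: times_bicyclic.abs_eq)
    \<comment> \<open>Zero exponents are written out so that a single letter is itself a normal form
      and the product rule applies.\<close>
    moreover have "abs_bicyclic [l] = bicyclic_q ^ 0 * bicyclic_p ^ 1 \<or>
        abs_bicyclic [l] = bicyclic_q ^ 1 * bicyclic_p ^ 0"
      by (cases l) (simp_all add: bicyclic_p.abs_eq bicyclic_q.abs_eq)
    ultimately show ?case
      using w bicyclic_mult_normal_form by metis
  qed
  then show ?thesis
    by (induction x rule: bicyclic.abs_induct)
qed

section \<open>Coordinates of bicyclic elements\<close>

fun letter_coords :: "letter \<Rightarrow> int \<times> int" where
  "letter_coords P = (0, 1)"
| "letter_coords Q = (1, 0)"

definition word_coords :: "letter list \<Rightarrow> int \<times> int" where
  "word_coords w = foldr (\<lambda>l z. letter_coords l \<odot> z) w (0, 0)"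

text \<open>The product \<open>(0, 1) \<odot> (1, 0) = (0, 0)\<close> fixes a point on its right
  only if the first coordinate of that point is nonnegative; staying in the quadrant is what makes
  deleting \<open>[P, Q]\<close> harmless.\<close>

lemma word_coords_nonneg: "word_coords w \<in> ext_from 0"
proof (induction w)
  case (Cons l w)
  then show ?case
    by (cases l; cases "word_coords w") (auto simp: word_coords_def ext_from_def ext_mult_max)
qed (simp add: word_coords_def ext_from_def)

lemma word_coords_delete_pq:
  assumes "delete_pq w w'"
  shows "word_coords w = word_coords w'"
proof -
  obtain u v where w: "w = u @ [P, Q] @ v" "w' = u @ v"
    using assms by (auto simp: delete_pq_def)
  have "(0, 1) \<odot> ((1, 0) \<odot> word_coords v) = word_coords v"
    using word_coords_nonneg[of v] by (auto simp: ext_from_def ext_mult_max)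
  then show ?thesis
    by (simp add: w word_coords_def)
qed

lift_definition bicyclic_coords :: "bicyclic \<Rightarrow> int \<times> int" is word_coords
proof -
  fix w w' assume "bicyclic_cong w w'"
  then show "word_coords w = word_coords w'"
    unfolding bicyclic_cong_def
    by (induction rule: equivclp_induct) (auto dest: word_coords_delete_pq)
qed

lemma bicyclic_coords_one: "bicyclic_coords 1 = (0, 0)"
  by transfer (simp add: word_coords_def)

lemma bicyclic_coords_p: "bicyclic_coords (bicyclic_p * x) = (0, 1) \<odot> bicyclic_coords x"
  by transfer (simp add: word_coords_def)

lemma bicyclic_coords_q: "bicyclic_coords (bicyclic_q * x) = (1, 0) \<odot> bicyclic_coords x"
  by transfer (simp add: word_coords_def)

lemma bicyclic_coords_normal_form:
  "bicyclic_coords (bicyclic_q ^ i * bicyclic_p ^ j) = (int i, int j)"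
\<comment> \<open>The powers of \<open>bicyclic_p\<close> act first, on points
  \<open>(0, j)\<close>, where \<open>(0, 1)\<close> just raises the second coordinate; each
  \<open>bicyclic_q\<close> then raises the first.\<close>
proof (induction i)
  case 0
  show ?case
    by (induction j) (auto simp: bicyclic_coords_one bicyclic_coords_p ext_mult_max)
next
  case (Suc i)
  then show ?case
    by (simp add: mult.assoc bicyclic_coords_q ext_mult_max)
qed

section \<open>The isomorphism with the bicyclic semigroup\<close>

lemma subsemigroup_ext_from: "subsemigroup (\<odot>) (ext_from n)"
proof -
  have "(n, n) \<in> ext_from n"
    by (simp add: ext_from_def)
  then show ?thesis
    by (auto simp: subsemigroup_def semigroup_ext_mult ext_from_def ext_mult_max)
qed

lemma ext_from_isomorphism:
  "semigroup_isomorphism (\<odot>) (ext_from n) (*) UNIV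
     (\<lambda>(a, b). bicyclic_q ^ nat (a - n) * bicyclic_p ^ nat (b - n))"
    (is "semigroup_isomorphism _ _ _ _ ?h")
proof -
  have "inj_on ?h (ext_from n)"
  proof (rule inj_onI)
    fix x y assume xy: "x \<in> ext_from n" "y \<in> ext_from n" and "?h x = ?h y"
    \<comment> \<open>On \<open>ext_from n\<close>, \<open>bicyclic_coords\<close> undoes
      \<open>?h\<close> up to translation by \<open>n\<close>.\<close>
    then have "bicyclic_coords (?h x) = bicyclic_coords (?h y)"
      by simp
    with xy show "x = y"
      by (auto simp: bicyclic_coords_normal_form ext_from_def)
  qed
  moreover have "?h ` ext_from n = UNIV"
  proof -
    have "x \<in> ?h ` ext_from n" for x
    proof -
      obtain i j where "x = bicyclic_q ^ i * bicyclic_p ^ j"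
        using bicyclic_normal_form by blast
      then have "x = ?h (n + int i, n + int j)" "(n + int i, n + int j) \<in> ext_from n"
        by (simp_all add: ext_from_def)
      then show ?thesis by blast
    qed
    then show ?thesis by blast
  qed
  moreover have "?h (x \<odot> y) = ?h x * ?h y" if "x \<in> ext_from n" "y \<in> ext_from n" for x y
  proof -
    obtain a b c d where xy: "x = (a, b)" "y = (c, d)"
      by (cases x; cases y)
    \<comment> \<open>All coordinates are at least \<open>n\<close>, so \<open>nat\<close> loses
      nothing, and the truncated differences on the right are \<open>max b c - b\<close> and
      \<open>max b c - c\<close>.\<close>
    have "nat (a - b + max b c - n) = nat (a - n) + (nat (c - n) - nat (b - n))"
      "nat (d - c + max b c - n) = (nat (b - n) - nat (c - n)) + nat (d - n)"
      using that by (auto simp: xy ext_from_def)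
    then show ?thesis
      by (simp add: xy ext_mult_max bicyclic_mult_normal_form)
  qed
  moreover have "subsemigroup ((*) :: bicyclic \<Rightarrow> bicyclic \<Rightarrow> bicyclic) UNIV"
    by (simp add: subsemigroup_def mult.semigroup_axioms)
  ultimately show ?thesis
    by (simp add: semigroup_isomorphism_def subsemigroup_ext_from bij_betw_def)
qed

theorem proposition2p1:
  shows
    "(idempotents (\<odot>) = {(a, a) | a. a \<in> UNIV} \<and>
      (\<forall>a b. natural_le (\<odot>) (a, a) (b, b) \<longleftrightarrow> a \<ge> b) \<and>
      linearly_ordered_semilattice (max :: int \<Rightarrow> int \<Rightarrow> int) \<and>
      isomorphic_semigroups (\<odot>) (idempotents (\<odot>)) (max :: int \<Rightarrow> int \<Rightarrow> int) UNIV) \<and>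
     (inverse_semigroup (\<odot>) \<and> (\<forall>a b. inverse_elements (\<odot>) (a, b) (b, a))) \<and>
     (\<forall>e \<in> idempotents (\<odot>). \<forall>f \<in> idempotents (\<odot>).
        \<exists>x. x \<odot> inverse_of (\<odot>) x = e \<and> inverse_of (\<odot>) x \<odot> x = f) \<and>
     (\<forall>a b c d.
        (green_R (\<odot>) (a, b) (c, d) \<longleftrightarrow> a = c) \<and>
        (green_L (\<odot>) (a, b) (c, d) \<longleftrightarrow> b = d) \<and>
        (green_H (\<odot>) (a, b) (c, d) \<longleftrightarrow> a = c \<and> b = d) \<and>
        green_D (\<odot>) (a, b) (c, d) \<and>
        green_J (\<odot>) (a, b) (c, d)) \<and>
     (bisimple (\<odot>) \<and> simple (\<odot>)) \<and>
     (\<forall>a b c d x y. (a, b) \<odot> (c, d) = (x, y) \<longrightarrow> x - y = a - b + c - d) \<and>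
     (\<forall>G. maximal_subgroup (\<odot>) G \<longrightarrow> is_singleton G) \<and>
     (\<forall>n. subsemigroup (\<odot>) (ext_from n) \<and>
        isomorphic_semigroups (\<odot>) (ext_from n) ((*) :: bicyclic \<Rightarrow> bicyclic \<Rightarrow> bicyclic) UNIV \<and>
        semigroup_isomorphism (\<odot>) (ext_from n) (*) UNIV
          (\<lambda>(a, b). bicyclic_q ^ nat (a - n) * bicyclic_p ^ nat (b - n))) \<and>
     range ext_left = {I. left_ideal (\<odot>) I \<and> I \<noteq> UNIV} \<and>
     range ext_right = {I. right_ideal (\<odot>) I \<and> I \<noteq> UNIV}"
proof (intro conjI allI ballI impI)
  fix e f
  assume "e \<in> idempotents (\<odot>)" "f \<in> idempotents (\<odot>)"
  then obtain a b where "e = (a, a)" "f = (b, b)"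
    by (auto simp: idempotents_ext_mult)
  \<comment> \<open>The element \<open>(a, b)\<close> joins the two idempotents: its inverse is
    \<open>(b, a)\<close>, so the products are \<open>(a, a)\<close> and
    \<open>(b, b)\<close>.\<close>
  then have "(a, b) \<odot> inverse_of (\<odot>) (a, b) = e \<and> inverse_of (\<odot>) (a, b) \<odot> (a, b) = f"
    by (simp add: inverse_of_ext_mult ext_mult_max)
  then show "\<exists>x. x \<odot> inverse_of (\<odot>) x = e \<and> inverse_of (\<odot>) x \<odot> x = f"
    by blast
next
  show "isomorphic_semigroups (\<odot>) (idempotents (\<odot>)) (max :: int \<Rightarrow> int \<Rightarrow> int) UNIV"
    unfolding isomorphic_semigroups_def using idempotents_ext_mult_isomorphism by blast
next
  fix n
  show "isomorphic_semigroups (\<odot>) (ext_from n) ((*) :: bicyclic \<Rightarrow> bicyclic \<Rightarrow> bicyclic) UNIV"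
    unfolding isomorphic_semigroups_def using ext_from_isomorphism by blast
next
  fix a b c d x y
  assume "(a, b) \<odot> (c, d) = (x, y)"
  then show "x - y = a - b + c - d"
    by (auto simp: ext_mult_max)
next
  fix G
  assume "maximal_subgroup (\<odot>) G"
  then show "is_singleton G"
    by (simp add: maximal_subgroup_def subgroup_ext_mult_singleton)
qed (simp_all only: idempotents_ext_mult natural_le_ext_mult linearly_ordered_semilattice_max
    inverse_semigroup_ext_mult inverse_elements_ext_mult green_R_ext_mult green_L_ext_mult
    green_H_ext_mult green_D_ext_mult green_J_ext_mult bisimple_ext_mult simple_ext_mult
    subsemigroup_ext_from ext_from_isomorphism left_ideals_ext_mult right_ideals_ext_mult simp_thms)

end
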